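(* Let $R(z)=2z(2-z)$ and let $\zeta_{R,0}$ be the zeta function of the polynomial $R$ with base point $z_0=0$. Then the Riemann zeta function $\zeta$ has the representation $$\zeta(s)=\tfrac12\,C^{s}\,\zeta_{R,0}(s),\qquad C=\sqrt2\,\pi,$$ for $\operatorname{Re}(s)>1$ (and hence also for the meromorphic continuations).
   Context: For a polynomial $R$ of degree $N\ge2$ with $R(0)=0$, $c=R'(0)>1$ and Julia set contained in $[0,\infty)$, the zeta function of $R$ with base point $z_0=0$ is $$\zeta_{R,0}(s)=\lim_{n\to\infty}\sum_{z\in R^{-n}\{0\}\setminus\{0\}}(c^n z)^{-s/2},\qquad \operatorname{Re}(s)>d_R=\frac{2\log N}{\log c},$$ where $R^{-n}\{0\}$ denotes the $N^n$ preimages of $0$ under the $n$-th iterate of $R$, counted with multiplicity, and the preimage $z=0$ is omitted from the sum. For $R(z)=2z(2-z)$ one has $N=2$, $c=4$, $d_R=1$, and the Julia set is $[0,2]$. *)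

theory Defs
  imports "HOL-Complex_Analysis.Complex_Analysis"
begin

definition iter_poly :: "nat \<Rightarrow> complex poly \<Rightarrow> complex poly" where
  "iter_poly n R = ((\<lambda>p. R \<circ>\<^sub>p p) ^^ n) [:0, 1:]"

text \<open>
  Preimages of 0 under the n-th iterate are the elements of the multiset of roots of the
  iterate, so they are counted with multiplicity. For the polynomials of interest
  (Julia set in the nonnegative real axis, multiplier greater than 1) the base of the power
  is a positive real, so the principal branch used by \<^term>\<open>(powr)\<close> is the intended one.
\<close>

definition zeta_R_sum :: "complex poly \<Rightarrow> nat \<Rightarrow> complex \<Rightarrow> complex" where
  "zeta_R_sum R n s =
     (let c = poly (pderiv R) 0
      in \<Sum>z\<in>#filter_mset (\<lambda>z. z \<noteq> 0) (proots (iter_poly n R)). (c ^ n * z) powr (- s / 2))"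

text \<open>
  The zeta function of a polynomial with base point 0, meaningful where the limit exists
  (\<^const>\<open>lim\<close> is otherwise unspecified).
\<close>

definition zeta_R :: "complex poly \<Rightarrow> complex \<Rightarrow> complex" where
  "zeta_R R s = lim (\<lambda>n. zeta_R_sum R n s)"

text \<open>The Dirichlet series of the Riemann zeta function, meaningful for real part greater than 1.\<close>

definition riemann_zeta :: "complex \<Rightarrow> complex" where
  "riemann_zeta s = (\<Sum>n. of_nat (Suc n) powr (- s))"

text \<open>
  Since \<open>nicely_meromorphic_on\<close> fixes the value 0 at poles and removes removable singularities,
  a continuation of a function from a nonempty open set to a larger connected open set is
  unique as a function.
\<close>

definition meromorphic_continuation ::
  "(complex \<Rightarrow> complex) \<Rightarrow> complex set \<Rightarrow> (complex \<Rightarrow> complex) \<Rightarrow> complex set \<Rightarrow> bool" where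
  "meromorphic_continuation f A F U \<longleftrightarrow>
     open U \<and> connected U \<and> A \<subseteq> U \<and> F nicely_meromorphic_on U \<and> (\<forall>s\<in>A. F s = f s)"

end

theory Submission
  imports Defs "HOL-Real_Asymp.Real_Asymp"
begin

text \<open>
  Substituting \<open>z = 2 sin\<^sup>2 \<theta>\<close> turns \<open>R(z) = 2z(2 - z)\<close> into angle doubling, so the preimages of \<open>0\<close> under
  the \<open>n\<close>-th iterate, with multiplicity, are \<open>2 sin\<^sup>2 (k\<pi> / 2^n)\<close> for \<open>0 \<le> k < 2^n\<close>. As \<open>c = 4\<close>, the \<open>k\<close>-th
  summand is \<open>(\<surd>2 2^n sin (k\<pi> / 2^n))\<close> to the power \<open>-s\<close>, which tends to \<open>(\<surd>2 \<pi> k)\<close> to the power \<open>-s\<close>.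
  The sum is symmetric under \<open>k \<mapsto> 2^n - k\<close>; on each half \<open>sin x \<ge> x / 3\<close> gives the summable bound
  needed for Tannery's theorem, and the two halves produce the factor 2.
  For the continuations, the difference of the two sides vanishes near every point except possibly at
  the point itself, and a nicely meromorphic function is determined there by its values nearby.
\<close>

section \<open>Preimages of 0 through angle halving\<close>

lemma sum_lessThan_double:
  fixes f :: "nat \<Rightarrow> 'a :: comm_monoid_add"
  shows "(\<Sum>k<2 * n. f k) = (\<Sum>k<n. f (2 * k)) + (\<Sum>k<n. f (2 * k + 1))"
  by (induction n) (simp_all add: ac_simps)

text \<open>The roots of \<open>2 * z * (2 - z) = 2 * (sin \<theta>)^2\<close> are
  \<open>2 * u^2\<close> and \<open>2 * v^2\<close> for the sine \<open>u\<close> and cosine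
  \<open>v\<close> of \<open>\<theta> / 2\<close>: their sum is 2 and their product is
  \<open>(sin \<theta>)^2\<close>. The cosine is written as a sine of a shifted angle so that both
  targets have the original shape and the splitting can be repeated.\<close>

lemma pcompose_minus_const_sin:
  fixes p :: "complex poly"
  shows "[:0, 4, -2:] \<circ>\<^sub>p p - [:of_real (2 * (sin \<theta>)\<^sup>2):] =
           smult (-2) ((p - [:of_real (2 * (sin (\<theta> / 2))\<^sup>2):]) *
                       (p - [:of_real (2 * (sin ((\<theta> + pi) / 2))\<^sup>2):]))"
proof -
  define u v where "u = complex_of_real (sin (\<theta> / 2))" and "v = complex_of_real (cos (\<theta> / 2))"
  have 1: "complex_of_real (sin ((\<theta> + pi) / 2)) = v"
    by (simp add: v_def add_divide_distrib sin_add)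
  have 2: "complex_of_real (sin \<theta>) = 2 * u * v"
    using sin_double[of "\<theta> / 2"] by (simp add: u_def v_def)
  have "u\<^sup>2 + v\<^sup>2 = of_real ((sin (\<theta> / 2))\<^sup>2 + (cos (\<theta> / 2))\<^sup>2)"
    unfolding u_def v_def by (simp only: of_real_add of_real_power)
  also have "\<dots> = 1" by (simp only: sin_cos_squared_add of_real_1)
  finally have 3: "v\<^sup>2 = 1 - u\<^sup>2" by (simp add: algebra_simps)
  show ?thesis
  proof (rule poly_eq_poly_eq_iff[THEN iffD1], rule ext)
    fix z
    have "poly p z * (4 + - (2 * poly p z)) - 2 * (4 * u\<^sup>2 * v\<^sup>2) =
          - (2 * ((poly p z - 2 * u\<^sup>2) * (poly p z - 2 * v\<^sup>2)))"
      unfolding 3 by (simp add: algebra_simps power2_eq_square)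
    then show "poly ([:0, 4, -2:] \<circ>\<^sub>p p - [:of_real (2 * (sin \<theta>)\<^sup>2):]) z =
        poly (smult (-2) ((p - [:of_real (2 * (sin (\<theta> / 2))\<^sup>2):]) *
                       (p - [:of_real (2 * (sin ((\<theta> + pi) / 2))\<^sup>2):]))) z"
      unfolding of_real_mult of_real_power 1 2 u_def[symmetric]
      by (simp add: poly_pcompose power_mult_distrib algebra_simps)
  qed
qed

lemma iter_poly_0 [simp]: "iter_poly 0 R = [:0, 1:]"
  by (simp add: iter_poly_def)

lemma iter_poly_Suc [simp]: "iter_poly (Suc n) R = R \<circ>\<^sub>p iter_poly n R"
  by (simp add: iter_poly_def)

lemma degree_iter_poly: "degree (iter_poly n R) = degree R ^ n"
  by (induction n) (simp_all add: degree_pcompose)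

text \<open>Only \<open>\<theta> = 0\<close> is needed later, but peeling off the outermost map
  replaces the target angle by \<open>\<theta> / 2\<close> and \<open>(\<theta> + pi) / 2\<close>,
  hence the general \<open>\<theta>\<close>. These two angles supply the even and the odd indices
  \<open>k\<close>. An arbitrary \<open>f\<close> keeps track of multiplicities.\<close>

lemma sum_proots_iter_poly:
  fixes f :: "complex \<Rightarrow> 'a :: comm_monoid_add"
  shows "(\<Sum>z\<in>#proots (iter_poly n [:0, 4, -2:] - [:of_real (2 * (sin \<theta>)\<^sup>2):]). f z) =
         (\<Sum>k<2 ^ n. f (of_real (2 * (sin ((\<theta> + of_nat k * pi) / 2 ^ n))\<^sup>2)))"
proof (induction n arbitrary: \<theta>)
  case 0
  show ?case by simp
next
  case (Suc n)
  \<comment> \<open>The roots of a product split only for nonzero factors; here the degree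
    \<open>2 ^ n\<close> is positive even for \<open>n = 0\<close>.\<close>
  have nz: "iter_poly n [:0, 4, -2:] - [:a:] \<noteq> 0" for a :: complex
  proof
    assume "iter_poly n [:0, 4, -2:] - [:a:] = 0"
    hence "degree (iter_poly n [:0, 4, -2 :: complex:]) = degree [:a:]" by simp
    thus False by (simp add: degree_iter_poly)
  qed
  have "(\<theta> / 2 + real k * pi) / 2 ^ n = (\<theta> + real (2 * k) * pi) / 2 ^ Suc n"
       "((\<theta> + pi) / 2 + real k * pi) / 2 ^ n = (\<theta> + real (2 * k + 1) * pi) / 2 ^ Suc n" for k
    by (simp_all add: field_simps)
  note angles = this
  have "proots (iter_poly (Suc n) [:0, 4, -2:] - [:of_real (2 * (sin \<theta>)\<^sup>2):]) =
          proots (iter_poly n [:0, 4, -2:] - [:of_real (2 * (sin (\<theta> / 2))\<^sup>2):]) +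
          proots (iter_poly n [:0, 4, -2:] - [:of_real (2 * (sin ((\<theta> + pi) / 2))\<^sup>2):])"
    unfolding iter_poly_Suc pcompose_minus_const_sin
    by (subst proots_smult, simp, rule proots_mult[OF nz nz])
  thus ?case
    by (simp only: image_mset_union sum_mset.union Suc.IH angles
          power_Suc[of "2 :: nat" n] sum_lessThan_double)
qed

section \<open>Partial sums as sums of powers of sines\<close>

text \<open>For positive \<open>x\<close> the principal logarithm of the square is
  \<open>2 * ln x\<close>, so halving the exponent crosses no branch; at 0 both powers are
  0.\<close>

lemma of_real_square_powr_half:
  assumes "x \<ge> 0"
  shows "complex_of_real (x\<^sup>2) powr (s / 2) = of_real x powr s"
proof (cases "x = 0")
  case False
  with assms have "Ln (complex_of_real (x\<^sup>2)) = 2 * of_real (ln x)"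
    by (simp add: Ln_of_real ln_realpow del: of_real_power)
  with False assms show ?thesis by (simp add: powr_def Ln_of_real)
qed simp

lemma zeta_R_sum_quadratic:
  "zeta_R_sum [:0, 4, -2:] n s =
     (\<Sum>k<2 ^ n. of_real (sqrt 2 * 2 ^ n * sin (of_nat k * pi / 2 ^ n)) powr (-s))"
proof -
  define f where "f z = (4 ^ n * z) powr (-s / 2)" for z :: complex
  have "zeta_R_sum [:0, 4, -2:] n s =
          (\<Sum>z\<in>#filter_mset (\<lambda>z. z \<noteq> 0) (proots (iter_poly n [:0, 4, -2:])). f z)"
    by (simp add: zeta_R_sum_def f_def pderiv_pCons)
  also have "\<dots> = (\<Sum>z\<in>#proots (iter_poly n [:0, 4, -2:]). f z)"
  proof -
    have "(\<Sum>z\<in>#filter_mset (\<lambda>z. z \<noteq> 0) A. f z) = (\<Sum>z\<in>#A. f z)" for A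
      \<comment> \<open>the summand at \<open>0\<close> is harmless, since \<open>0 powr w = 0\<close> for every \<open>w\<close>\<close>
      by (induction A) (auto simp: f_def)
    thus ?thesis .
  qed
  also have "\<dots> = (\<Sum>k<2 ^ n. f (of_real (2 * (sin (of_nat k * pi / 2 ^ n))\<^sup>2)))"
    using sum_proots_iter_poly[of f n 0] by simp
  also have "\<dots> = (\<Sum>k<2 ^ n. of_real (sqrt 2 * 2 ^ n * sin (of_nat k * pi / 2 ^ n)) powr (-s))"
  proof (intro sum.cong refl)
    fix k :: nat assume k: "k \<in> {..<2 ^ n}"
    define x where "x = sin (of_nat k * pi / 2 ^ n)"
    \<comment> \<open>The angle lies between 0 and \<open>pi\<close>, so the sine is nonnegative and
      is the correct square root.\<close>
    from k have "real k \<le> 2 ^ n"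
      by (metis lessThan_iff less_imp_le of_nat_le_iff of_nat_numeral of_nat_power)
    hence "x \<ge> 0"
      unfolding x_def by (intro sin_ge_zero) (auto simp: field_simps)
    hence "of_real ((sqrt 2 * 2 ^ n * x)\<^sup>2) powr (-s / 2) = of_real (sqrt 2 * 2 ^ n * x) powr (-s)"
      by (intro of_real_square_powr_half) auto
    moreover have "complex_of_real ((sqrt 2 * 2 ^ n * x)\<^sup>2) = 4 ^ n * of_real (2 * x\<^sup>2)"
    proof -
      have "(2 ^ n)\<^sup>2 = (4 :: real) ^ n"
        by (simp flip: power_mult_distrib add: power2_eq_square)
      hence "(sqrt 2 * 2 ^ n * x)\<^sup>2 = 4 ^ n * (2 * x\<^sup>2)"
        by (simp add: power_mult_distrib)
      thus ?thesis by (simp only: of_real_mult of_real_power of_real_numeral)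
    qed
    ultimately show "f (of_real (2 * x\<^sup>2)) = of_real (sqrt 2 * 2 ^ n * x) powr (-s)"
      unfolding f_def by metis
  qed
  finally show ?thesis .
qed

section \<open>Symmetry of the sum and passage to the limit\<close>

text \<open>The reflection of \<open>k\<close> to \<open>2 ^ Suc n - k\<close> preserves the sine.
  Its fixed point \<open>2 ^ n\<close> is counted once, and index 0, which has no partner in the
  range, contributes 0.\<close>

lemma sum_powr_sin_symmetric:
  fixes s c :: complex and n :: nat
  defines "t \<equiv> \<lambda>k. (c * of_real (sin (of_nat k * pi / 2 ^ Suc n))) powr s"
  shows "(\<Sum>k<2 ^ Suc n. t k) = 2 * (\<Sum>k<2 ^ n. t k) + t (2 ^ n)"
proof -
  have sym: "t (2 ^ n + (2 ^ n - Suc k)) = t (Suc k)" if "k < 2 ^ n" for k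
  proof -
    have "real (2 ^ n + (2 ^ n - Suc k)) = 2 ^ Suc n - real (Suc k)"
      using that by (simp add: of_nat_diff Suc_le_eq)
    hence "real (2 ^ n + (2 ^ n - Suc k)) * pi / 2 ^ Suc n = (2 ^ Suc n - real (Suc k)) * pi / 2 ^ Suc n"
      by (simp only:)
    also have "\<dots> = pi - real (Suc k) * pi / 2 ^ Suc n"
      by (simp add: field_simps)
    finally have "real (2 ^ n + (2 ^ n - Suc k)) * pi / 2 ^ Suc n = pi - real (Suc k) * pi / 2 ^ Suc n" .
    thus ?thesis unfolding t_def by (simp only: sin_pi_minus)
  qed
  have "(\<Sum>k<m + l. t k) = (\<Sum>k<m. t k) + (\<Sum>k<l. t (m + k))" for m l
    by (induction l) (simp_all add: add.assoc)
  from this[of "2 ^ n" "2 ^ n"]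
  have "(\<Sum>k<2 ^ Suc n. t k) = (\<Sum>k<2 ^ n. t k) + (\<Sum>k<2 ^ n. t (2 ^ n + k))"
    by (simp only: power_Suc mult_2)
  also have "(\<Sum>k<2 ^ n. t (2 ^ n + k)) = (\<Sum>k<2 ^ n. t (2 ^ n + (2 ^ n - Suc k)))"
    by (rule sum.nat_diff_reindex[symmetric])
  also have "\<dots> = (\<Sum>k<2 ^ n. t (Suc k))"
    by (intro sum.cong refl sym) simp
  \<comment> \<open>Moving the range from \<open>1..2 ^ n\<close> back to
    \<open>0..2 ^ n - 1\<close> adds \<open>t 0 = 0\<close> and leaves the middle term over.\<close>
  also have "\<dots> = (\<Sum>k<2 ^ n. t k) + t (2 ^ n)"
    using sum.lessThan_Suc_shift[of t "2 ^ n"] by (simp add: t_def)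
  finally show ?thesis by (simp add: algebra_simps)
qed

text \<open>Since \<open>x^2 \<le> 4\<close> on this range, \<open>x - x^3 / 6\<close> is at least
  \<open>x - 4 * x / 6 = x / 3\<close>.\<close>

lemma sin_ge_third:
  fixes x :: real
  assumes "0 \<le> x" "x \<le> 2"
  shows "x / 3 \<le> sin x"
proof -
  have "\<bar>sin x - x\<bar> \<le> x ^ 3 / 6"
    using Maclaurin_sin_bound[of x 3] assms
    by (simp add: sin_coeff_def eval_nat_numeral lessThan_Suc field_simps)
  moreover have "x ^ 3 \<le> 4 * x"
    using assms mult_mono[of x 2 x 2] mult_left_mono[of "x * x" 4 x]
    by (simp add: eval_nat_numeral mult.commute)
  ultimately show ?thesis by linarith
qed

lemma zeta_R_sum_quadratic_tendsto:
  assumes s: "Re s > 1"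
  shows "(\<lambda>n. zeta_R_sum [:0, 4, -2:] n s) \<longlonglongrightarrow>
           2 * of_real (sqrt 2 * pi) powr (-s) * riemann_zeta s"
proof -
  define t where "t n k = complex_of_real (sqrt 2 * 2 ^ n * sin (of_nat k * pi / 2 ^ n)) powr (-s)"
    for n k :: nat
  define b where "b k = complex_of_real (sqrt 2 * pi * of_nat k) powr (-s)" for k :: nat
  \<comment> \<open>Extending the lower half of the sum by 0 turns it into a series over all
    \<open>k\<close>; the shift to \<open>Suc n\<close> makes the midpoint
    \<open>2 ^ n\<close>.\<close>
  define a where "a k n = (if k < 2 ^ n then t (Suc n) k else 0)" for k n :: nat
  have lim_t: "(\<lambda>n. t n k) \<longlonglongrightarrow> b k" for k
  proof (cases "k = 0")
    case False
    define x where "x = real k * pi"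
    from False have "x > 0" by (simp add: x_def)
    hence "(\<lambda>n. 2 ^ n * sin (x / 2 ^ n)) \<longlonglongrightarrow> x"
      by real_asymp
    hence "(\<lambda>n. sqrt 2 * 2 ^ n * sin (x / 2 ^ n)) \<longlonglongrightarrow> sqrt 2 * x"
      by (simp only: mult.assoc tendsto_mult_left)
    \<comment> \<open>The limit of the bases avoids the branch cut, so the power is continuous
      there.\<close>
    moreover have "complex_of_real (sqrt 2 * x) \<notin> \<real>\<^sub>\<le>\<^sub>0"
      using \<open>x > 0\<close> by (auto simp: mult_le_0_iff simp del: of_real_mult)
    ultimately have "(\<lambda>n. complex_of_real (sqrt 2 * 2 ^ n * sin (x / 2 ^ n)) powr (-s))
        \<longlonglongrightarrow> complex_of_real (sqrt 2 * x) powr (-s)"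
      by (intro tendsto_powr_complex tendsto_of_real tendsto_const)
    thus ?thesis by (simp add: t_def b_def x_def mult_ac)
  qed (simp add: t_def b_def)
  have lim: "(\<lambda>n. a k n) \<longlonglongrightarrow> b k" for k
  proof (rule Lim_transform_eventually)
    show "(\<lambda>n. t (Suc n) k) \<longlonglongrightarrow> b k"
      using lim_t[of k] by (rule LIMSEQ_Suc)
    have "eventually (\<lambda>n. n \<ge> k) sequentially" by (rule eventually_ge_at_top)
    thus "eventually (\<lambda>n. t (Suc n) k = a k n) sequentially"
    proof eventually_elim
      case (elim n)
      hence "k < 2 ^ n" using less_exp[of n] by linarith
      thus ?case by (simp add: a_def)
    qed
  qed
  \<comment> \<open>The base is at least \<open>k\<close>, by \<open>sin_ge_third\<close>,
    \<open>pi > 3\<close> and \<open>sqrt 2 \<ge> 1\<close>; the negative exponent reverses the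
    inequality. The crude \<open>pi < 4\<close> already keeps the angle below 2.\<close>
  have bound: "norm (a k n) \<le> real k powr (- Re s)" for k n
  proof (cases "k < 2 ^ n \<and> k \<noteq> 0")
    case True
    define x where "x = real k * pi / 2 ^ Suc n"
    have "real k \<le> 2 ^ n"
      using True by (metis less_imp_le of_nat_le_iff of_nat_numeral of_nat_power)
    hence "real k * pi \<le> 2 ^ n * 4"
      using pi_less_4 by (intro mult_mono) auto
    hence x: "0 \<le> x" "x \<le> 2" unfolding x_def by (auto simp: field_simps)
    have "real k = 1 * 2 ^ Suc n * (real k / 2 ^ Suc n)" by simp
    also have "\<dots> \<le> sqrt 2 * 2 ^ Suc n * (x / 3)"
    proof (intro mult_mono)
      have "real k * 3 \<le> real k * pi" using pi_gt3 by (intro mult_left_mono) auto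
      thus "real k / 2 ^ Suc n \<le> x / 3" by (simp add: x_def field_simps)
    qed auto
    also have "\<dots> \<le> sqrt 2 * 2 ^ Suc n * sin x"
      using sin_ge_third[OF x] by (intro mult_left_mono) auto
    finally have le: "real k \<le> sqrt 2 * 2 ^ Suc n * sin x" .
    have "a k n = complex_of_real (sqrt 2 * 2 ^ Suc n * sin x) powr (-s)"
      using True by (simp add: a_def t_def x_def)
    moreover have "0 \<le> sqrt 2 * 2 ^ Suc n * sin x"
      using le by linarith
    ultimately have "norm (a k n) = (sqrt 2 * 2 ^ Suc n * sin x) powr (- Re s)"
      by (simp add: norm_powr_real_powr del: of_real_mult)
    also have "\<dots> \<le> real k powr (- Re s)"
      using le True s by (intro powr_mono2') auto
    finally show ?thesis .
  qed (auto simp: a_def t_def)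
  have "(\<lambda>n. \<Sum>k. a k n) \<longlonglongrightarrow> (\<Sum>k. b k)"
    using tannerys_theorem[of a b sequentially "\<lambda>k. real k powr (- Re s)"] lim bound s
    by (auto simp: summable_real_powr_iff always_eventually)
  moreover have "(\<Sum>k. a k n) = (\<Sum>k<2 ^ n. t (Suc n) k)" for n
    by (subst suminf_finite[of "{..<2 ^ n}"]) (auto simp: a_def)
  moreover have "(\<Sum>k. b k) = of_real (sqrt 2 * pi) powr (-s) * riemann_zeta s"
  proof -
    have b: "b k = of_real (sqrt 2 * pi) powr (-s) * of_nat k powr (-s)" for k
    proof -
      have "b k = (complex_of_real (sqrt 2 * pi) * of_nat k) powr (-s)"
        by (simp only: b_def of_real_mult of_real_of_nat_eq)
      also have "\<dots> = of_real (sqrt 2 * pi) powr (-s) * of_nat k powr (-s)"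
        by (rule powr_times_real) (simp_all del: of_real_mult)
      finally show ?thesis .
    qed
    have summ: "summable (\<lambda>k. complex_of_nat k powr (-s))"
      by (rule summable_norm_cancel) (use s in \<open>simp add: norm_powr_real_powr summable_real_powr_iff\<close>)
    hence "(\<Sum>k. b k) = of_real (sqrt 2 * pi) powr (-s) * (\<Sum>k. complex_of_nat k powr (-s))"
      unfolding b by (rule suminf_mult)
    \<comment> \<open>\<open>riemann_zeta\<close> starts at 1, and the extra term at index 0 is
      0.\<close>
    also have "(\<Sum>k. complex_of_nat k powr (-s)) = riemann_zeta s"
      unfolding riemann_zeta_def suminf_split_head[OF summ] by simp
    finally show ?thesis .
  qed
  ultimately have half: "(\<lambda>n. \<Sum>k<2 ^ n. t (Suc n) k) \<longlonglongrightarrow>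
      of_real (sqrt 2 * pi) powr (-s) * riemann_zeta s" by simp
  \<comment> \<open>This is the unpaired middle term, where the sine equals 1.\<close>
  have "(\<lambda>n. complex_of_real (sqrt 2 * 2 ^ Suc n) powr (-s)) \<longlonglongrightarrow> 0"
  proof (rule tendsto_neg_powr_complex_of_real)
    show "filterlim (\<lambda>n. sqrt 2 * 2 ^ Suc n) at_top sequentially" by real_asymp
  qed (use s in auto)
  hence "(\<lambda>n. t (Suc n) (2 ^ n)) \<longlonglongrightarrow> 0" by (simp add: t_def)
  with half have "(\<lambda>n. 2 * (\<Sum>k<2 ^ n. t (Suc n) k) + t (Suc n) (2 ^ n)) \<longlonglongrightarrow>
      2 * (of_real (sqrt 2 * pi) powr (-s) * riemann_zeta s) + 0"
    by (intro tendsto_intros)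
  moreover have "zeta_R_sum [:0, 4, -2:] (Suc n) s =
      2 * (\<Sum>k<2 ^ n. t (Suc n) k) + t (Suc n) (2 ^ n)" for n
    using sum_powr_sin_symmetric[of "of_real (sqrt 2 * 2 ^ Suc n)" n "-s"]
    unfolding zeta_R_sum_quadratic t_def of_real_mult[of "sqrt 2 * 2 ^ Suc n"] by simp
  ultimately have "(\<lambda>n. zeta_R_sum [:0, 4, -2:] (Suc n) s) \<longlonglongrightarrow>
      2 * of_real (sqrt 2 * pi) powr (-s) * riemann_zeta s" by (simp add: mult.assoc)
  thus ?thesis by (rule LIMSEQ_imp_Suc)
qed

section \<open>Uniqueness of nicely meromorphic continuations\<close>

text \<open>The factor must not vanish: a zero at a simple pole of \<open>g\<close> would leave the wrong value 0 there.\<close>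

lemma nicely_meromorphic_on_mult_analytic_nonzero:
  assumes f: "f analytic_on A" "\<And>z. z \<in> A \<Longrightarrow> f z \<noteq> 0" and g: "g nicely_meromorphic_on A"
  shows "(\<lambda>z. f z * g z) nicely_meromorphic_on A"
  unfolding nicely_meromorphic_on_def
proof (intro conjI ballI)
  show "(\<lambda>z. f z * g z) meromorphic_on A"
    using g analytic_on_imp_meromorphic_on[OF f(1)]
    by (auto simp: nicely_meromorphic_on_def intro: meromorphic_on_mult)
next
  fix z assume z: "z \<in> A"
  have fz: "f analytic_on {z}" using analytic_on_subset[OF f(1), of "{z}"] z by simp
  from g z consider "is_pole g z" "g z = 0" | "g \<midarrow>z\<rightarrow> g z"
    by (auto simp: nicely_meromorphic_on_def)
  thus "is_pole (\<lambda>z. f z * g z) z \<and> f z * g z = 0 \<or> (\<lambda>z. f z * g z) \<midarrow>z\<rightarrow> f z * g z"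
  proof cases
    case 1
    thus ?thesis using is_pole_mult_analytic_nonzero1[OF _ fz] f(2)[OF z] by auto
  next
    case 2
    have "f \<midarrow>z\<rightarrow> f z" using fz by (simp add: analytic_at_imp_isCont isContD)
    with 2 show ?thesis by (auto intro: tendsto_mult)
  qed
qed

text \<open>The value at \<open>z\<close> is 0 at a pole and the limit otherwise; both depend only
  on the values in a punctured neighbourhood.\<close>

lemma nicely_meromorphic_on_eq_at:
  assumes f: "f nicely_meromorphic_on {z}" and g: "g nicely_meromorphic_on {z}"
    and eq: "eventually (\<lambda>w. f w = g w) (at z)"
  shows "f z = g z"
proof -
  have pole: "is_pole f z \<longleftrightarrow> is_pole g z" using eq by (rule is_pole_cong) simp
  show ?thesis
  proof (cases "is_pole f z")
    case True
    thus ?thesis using f g pole by (metis is_pole_zero_at_nicely_mero singletonI)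
  next
    case False
    hence "f \<midarrow>z\<rightarrow> f z" "g \<midarrow>z\<rightarrow> g z"
      using f g pole by (auto simp: nicely_meromorphic_on_def)
    moreover have "f \<midarrow>z\<rightarrow> g z"
      using \<open>g \<midarrow>z\<rightarrow> g z\<close> eq by (metis (mono_tags, lifting) tendsto_cong)
    ultimately show ?thesis using LIM_unique by blast
  qed
qed

text \<open>The difference \<open>h\<close> is meromorphic but need not be nicely so: where poles
  cancel, its value may differ from its limit. The identity theorem is therefore applied to
  \<open>remove_sings h\<close>. This gives agreement near \<open>z\<close>, and
  \<open>nicely_meromorphic_on_eq_at\<close> carries it over to \<open>z\<close>.\<close>

lemma nicely_meromorphic_on_identity:
  assumes f: "f nicely_meromorphic_on U" and g: "g nicely_meromorphic_on U"
    and U: "open U" "connected U"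
    and A: "open A" "A \<noteq> {}" "A \<subseteq> U" and eq: "\<And>z. z \<in> A \<Longrightarrow> f z = g z"
    and z: "z \<in> U"
  shows "f z = g z"
proof -
  define h where "h w = f w - g w" for w
  have mero: "h meromorphic_on U"
    unfolding h_def using f g
    by (intro meromorphic_on_diff) (auto simp: nicely_meromorphic_on_def)
  have iso: "isolated_singularity_at h w" if "w \<in> U" for w
    using meromorphic_on_subset[OF mero] that by (intro meromorphic_on_isolated_singularity) auto
  from A obtain a where a: "a \<in> A" by auto
  have "eventually (\<lambda>w. w \<in> A) (at a)"
    using A a by (simp add: eventually_at_in_open')
  moreover have "eventually (\<lambda>w. remove_sings h w = h w) (at a)"
    using a A by (intro eventually_remove_sings_eq_at iso) auto
  ultimately have "eventually (\<lambda>w. remove_sings h w = 0) (at a)"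
    by eventually_elim (simp add: h_def eq)
  hence "frequently (\<lambda>w. remove_sings h w = 0) (at a)"
    by (intro eventually_frequently) auto
  hence zero: "remove_sings h w = 0" if "w \<in> U" for w
    using frequently_eq_meromorphic_imp_constant[OF _ remove_sings_nicely_meromorphic[OF mero] U]
      a A that by blast
  have "eventually (\<lambda>w. w \<in> U) (at z)"
    using U z by (simp add: eventually_at_in_open')
  moreover have "eventually (\<lambda>w. remove_sings h w = h w) (at z)"
    using z by (intro eventually_remove_sings_eq_at iso)
  ultimately have "eventually (\<lambda>w. f w = g w) (at z)"
    by eventually_elim (use zero in \<open>auto simp: h_def\<close>)
  thus ?thesis
    using f g z by (intro nicely_meromorphic_on_eq_at) (auto intro: nicely_meromorphic_on_subset)
qed

theorem theorem3:
  fixes R :: "complex poly" and C :: real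
  assumes R: "\<And>z. poly R z = 2 * z * (2 - z)"
    and C: "C = sqrt 2 * pi"
  shows "(\<forall>s. Re s > 1 \<longrightarrow>
            convergent (\<lambda>n. zeta_R_sum R n s) \<and>
            riemann_zeta s = 1 / 2 * of_real C powr s * zeta_R R s) \<and>
         (\<forall>U Z Y. meromorphic_continuation riemann_zeta {s. Re s > 1} Z U \<longrightarrow>
            meromorphic_continuation (zeta_R R) {s. Re s > 1} Y U \<longrightarrow>
            (\<forall>s\<in>U. Z s = 1 / 2 * of_real C powr s * Y s))"
proof -
  have R_eq: "R = [:0, 4, -2:]"
    by (rule poly_eq_poly_eq_iff[THEN iffD1]) (auto simp: R algebra_simps)
  have "C > 0" by (simp add: C)
  have half_plane: "convergent (\<lambda>n. zeta_R_sum R n s)"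
      "riemann_zeta s = 1 / 2 * of_real C powr s * zeta_R R s" if "Re s > 1" for s
  proof -
    have lim: "(\<lambda>n. zeta_R_sum R n s) \<longlonglongrightarrow> 2 * of_real C powr (-s) * riemann_zeta s"
      using zeta_R_sum_quadratic_tendsto[OF that] by (simp only: R_eq C)
    thus "convergent (\<lambda>n. zeta_R_sum R n s)" by (rule convergentI)
    show "riemann_zeta s = 1 / 2 * of_real C powr s * zeta_R R s"
      using \<open>C > 0\<close> by (simp add: zeta_R_def limI[OF lim] powr_minus field_simps)
  qed
  have "Z s = 1 / 2 * of_real C powr s * Y s"
    if Z: "meromorphic_continuation riemann_zeta {s. Re s > 1} Z U"
      and Y: "meromorphic_continuation (zeta_R R) {s. Re s > 1} Y U" and s: "s \<in> U" for U Z Y s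
  proof (rule nicely_meromorphic_on_identity[where f = Z and z = s
        and g = "\<lambda>s. 1 / 2 * of_real C powr s * Y s" and U = U and A = "{s. Re s > 1}"])
    show "Z nicely_meromorphic_on U" "open U" "connected U" "{s. Re s > 1} \<subseteq> U"
      using Z by (auto simp: meromorphic_continuation_def)
    \<comment> \<open>As \<open>C > 0\<close>, the factor in front of \<open>Y\<close> is entire and
      has no zeros.\<close>
    show "(\<lambda>s. 1 / 2 * of_real C powr s * Y s) nicely_meromorphic_on U"
      using Y \<open>C > 0\<close>
      by (intro nicely_meromorphic_on_mult_analytic_nonzero)
         (auto simp: meromorphic_continuation_def intro!: analytic_intros)
    show "open {s :: complex. Re s > 1}" by (rule open_halfspace_Re_gt)
    have "2 \<in> {s :: complex. Re s > 1}" by simp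
    thus "{s :: complex. Re s > 1} \<noteq> {}" by blast
    show "Z w = 1 / 2 * of_real C powr w * Y w" if "w \<in> {s. Re s > 1}" for w
      using Z Y half_plane(2)[of w] that by (simp add: meromorphic_continuation_def)
  qed (rule s)
  with half_plane show ?thesis by blast
qed

end
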